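(* Let $p$ and $q$ be distinct primes with $pq\neq 6$ and $q\mid p-1$. Let $r$ be an integer with $r^{q}\equiv 1 \pmod{p^{2}}$ and $r\not\equiv 1\pmod{p^2}$, and let $G=\langle a,b\mid a^{q^{2}}=b^{p^{2}}=1,\ a^{-1}ba=b^{r}\rangle$. Then $\mathrm{Aut}(G)\simeq \mathbb{Z}_{p^{2}}\rtimes(\mathbb{Z}_{p(p-1)}\times\mathbb{Z}_{q})$.
   Context: $\mathbb{Z}_n$ is the cyclic group of order $n$. $X\rtimes Y$ denotes a semidirect product with normal subgroup $X$ with respect to some homomorphism $Y\to\mathrm{Aut}(X)$; the statement asserts that $\mathrm{Aut}(G)$ is isomorphic to such a semidirect product for some choice of action. *)

theory Defs
  imports "HOL-Algebra.Bij" "HOL-Algebra.Elementary_Groups" "HOL-Number_Theory.Cong"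
begin

text \<open>
  A word over an alphabet is a list of signed letters: \<open>(x, True)\<close> stands for the letter
  \<open>x\<close> and \<open>(x, False)\<close> for its formal inverse.
\<close>

type_synonym 'a word = "('a \<times> bool) list"

abbreviation words :: "'a set \<Rightarrow> 'a word set"
  where "words S \<equiv> lists (S \<times> UNIV)"

inductive cancels :: "'a word \<Rightarrow> 'a word \<Rightarrow> bool"
  where "cancels (u @ [(x, e), (x, \<not> e)] @ v) (u @ v)"

definition free_rel :: "'a set \<Rightarrow> ('a word \<times> 'a word) set"
  where "free_rel S =
    {(u, v). u \<in> words S \<and> v \<in> words S \<and> equivclp cancels u v}"

definition free_group :: "'a set \<Rightarrow> 'a word set monoid"
  where "free_group S =
    \<lparr>carrier = words S // free_rel S,
     monoid.mult = \<lambda>U V. \<Union>u\<in>U. \<Union>v\<in>V. free_rel S `` {u @ v},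
     one = free_rel S `` {[]}\<rparr>"

definition free_gen :: "'a set \<Rightarrow> 'a \<Rightarrow> 'a word set"
  where "free_gen S x = free_rel S `` {[(x, True)]}"

definition normal_closure :: "('g, 'm) monoid_scheme \<Rightarrow> 'g set \<Rightarrow> 'g set"
  where "normal_closure F R = \<Inter>{N. N \<lhd> F \<and> R \<subseteq> N}"

definition presented_group :: "'a set \<Rightarrow> 'a word set set \<Rightarrow> 'a word set set monoid"
  where "presented_group S R = free_group S Mod normal_closure (free_group S) R"

text \<open>The relation \<open>a\<inverse> b a = b\<^sup>r\<close> becomes the relator \<open>a\<inverse> b a (b\<^sup>r)\<inverse>\<close>.\<close>

datatype letter = A | B

definition metacyclic_group ::
    "nat \<Rightarrow> nat \<Rightarrow> int \<Rightarrow> letter word set set monoid"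
  where "metacyclic_group m n r =
    (let F = free_group {A, B}; a = free_gen {A, B} A; b = free_gen {A, B} B in
     presented_group {A, B}
       {a [^]\<^bsub>F\<^esub> m,
        b [^]\<^bsub>F\<^esub> n,
        inv\<^bsub>F\<^esub> a \<otimes>\<^bsub>F\<^esub> b \<otimes>\<^bsub>F\<^esub> a \<otimes>\<^bsub>F\<^esub> inv\<^bsub>F\<^esub> (b [^]\<^bsub>F\<^esub> r)})"

definition semidirect ::
    "('x, 'm) monoid_scheme \<Rightarrow> ('y \<Rightarrow> 'x \<Rightarrow> 'x) \<Rightarrow> ('y, 'n) monoid_scheme
      \<Rightarrow> ('x \<times> 'y) monoid"
  where "semidirect X \<phi> Y =
    \<lparr>carrier = carrier X \<times> carrier Y,
     monoid.mult = \<lambda>(x, y) (x', y'). (x \<otimes>\<^bsub>X\<^esub> \<phi> y x', y \<otimes>\<^bsub>Y\<^esub> y'),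
     one = (\<one>\<^bsub>X\<^esub>, \<one>\<^bsub>Y\<^esub>)\<rparr>"


subsection \<open>The constructions above yield groups\<close>

lemma equivclp_cancels_context:
  assumes "equivclp cancels u v"
  shows "equivclp cancels (s @ u @ t) (s @ v @ t)"
  using assms
proof (induction rule: equivclp_induct)
  case base
  show ?case by simp
next
  case (step y z)
  have ctx: "cancels (s @ y @ t) (s @ z @ t)" if "cancels y z" for y z :: "'a word"
    using that
  proof cases
    case (1 u x e v)
    then show ?thesis
      using cancels.intros[of "s @ u" x e "v @ t"] by simp
  qed
  from step.hyps(2) have "equivclp cancels (s @ y @ t) (s @ z @ t)"
    using ctx by (metis equivclp_sym r_into_equivclp)
  with step.IH show ?case by (rule equivclp_trans)
qed

lemma equiv_free_rel: "equiv (words S) (free_rel S)"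
  by (auto simp: equiv_def refl_on_def sym_def trans_def free_rel_def
      intro: equivclp_sym equivclp_trans)

lemma free_rel_append:
  assumes "(u, u') \<in> free_rel S" "(v, v') \<in> free_rel S"
  shows "(u @ v, u' @ v') \<in> free_rel S"
proof -
  have "equivclp cancels (u @ v) (u' @ v)" "equivclp cancels (u' @ v) (u' @ v')"
    using assms equivclp_cancels_context[of u u' "[]" v] equivclp_cancels_context[of v v' u' "[]"]
    by (auto simp: free_rel_def)
  then have "equivclp cancels (u @ v) (u' @ v')"
    by (rule equivclp_trans)
  with assms show ?thesis
    by (auto simp: free_rel_def)
qed

lemma free_group_mult_class:
  assumes "u \<in> words S" "v \<in> words S"
  shows "free_rel S `` {u} \<otimes>\<^bsub>free_group S\<^esub> free_rel S `` {v} = free_rel S `` {u @ v}"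
proof -
  have "congruent2 (free_rel S) (free_rel S) (\<lambda>u v. free_rel S `` {u @ v})"
    by (auto intro!: congruent2I' equiv_class_eq[OF equiv_free_rel] free_rel_append)
  from UN_equiv_class2[OF equiv_free_rel equiv_free_rel this assms]
  show ?thesis by (simp add: free_group_def)
qed

lemma cancel_inverse_word:
  "equivclp cancels (rev (map (\<lambda>(x, e). (x, \<not> e)) u) @ u) []"
proof (induction u)
  case Nil
  show ?case by simp
next
  case (Cons l u)
  obtain x e where l: "l = (x, e)" by (cases l)
  let ?i = "rev (map (\<lambda>(x, e). (x, \<not> e)) u)"
  have "cancels (?i @ [(x, \<not> e), (x, \<not> \<not> e)] @ u) (?i @ u)"
    by (rule cancels.intros)
  then have "equivclp cancels (?i @ [(x, \<not> e), (x, e)] @ u) (?i @ u)"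
    by (simp add: r_into_equivclp)
  from equivclp_trans[OF this Cons.IH] show ?case
    by (simp add: l)
qed

lemma group_free_group: "group (free_group S)"
proof (rule groupI)
  have cls: "free_rel S `` {u} \<in> carrier (free_group S)" if "u \<in> words S" for u
    using that by (simp add: free_group_def quotientI)
  have ex: "\<exists>u\<in>words S. U = free_rel S `` {u}" if "U \<in> carrier (free_group S)" for U
    using that by (auto simp: free_group_def elim: quotientE)
  have one: "\<one>\<^bsub>free_group S\<^esub> = free_rel S `` {[]}"
    by (simp add: free_group_def)
  show "\<one>\<^bsub>free_group S\<^esub> \<in> carrier (free_group S)"
    by (simp add: one cls)
  fix U assume "U \<in> carrier (free_group S)"
  then obtain u where u: "u \<in> words S" "U = free_rel S `` {u}"
    using ex by blast
  show "\<one>\<^bsub>free_group S\<^esub> \<otimes>\<^bsub>free_group S\<^esub> U = U"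
    using u by (simp add: one free_group_mult_class)
  let ?i = "rev (map (\<lambda>(x, e). (x, \<not> e)) u)"
  have i: "?i \<in> words S"
    using u(1) by (auto simp: in_lists_conv_set)
  have "(?i @ u, []) \<in> free_rel S"
    using i u(1) cancel_inverse_word[of u] by (simp add: free_rel_def)
  then have "free_rel S `` {?i} \<otimes>\<^bsub>free_group S\<^esub> U = \<one>\<^bsub>free_group S\<^esub>"
    using i u by (simp add: one free_group_mult_class equiv_class_eq[OF equiv_free_rel])
  then show "\<exists>V\<in>carrier (free_group S). V \<otimes>\<^bsub>free_group S\<^esub> U = \<one>\<^bsub>free_group S\<^esub>"
    using cls[OF i] by blast
  fix V assume "V \<in> carrier (free_group S)"
  then obtain v where v: "v \<in> words S" "V = free_rel S `` {v}"
    using ex by blast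
  show "U \<otimes>\<^bsub>free_group S\<^esub> V \<in> carrier (free_group S)"
    using u v by (simp add: free_group_mult_class cls)
  fix W assume "W \<in> carrier (free_group S)"
  then obtain w where w: "w \<in> words S" "W = free_rel S `` {w}"
    using ex by blast
  show "U \<otimes>\<^bsub>free_group S\<^esub> V \<otimes>\<^bsub>free_group S\<^esub> W = U \<otimes>\<^bsub>free_group S\<^esub> (V \<otimes>\<^bsub>free_group S\<^esub> W)"
    using u v w by (simp add: free_group_mult_class)
qed

lemma (in group) normal_normal_closure:
  assumes "R \<subseteq> carrier G"
  shows "normal_closure G R \<lhd> G"
proof -
  have ne: "carrier G \<lhd> G"
    by (auto simp: normal_inv_iff subgroup_self)
  have "subgroup (\<Inter>{N. N \<lhd> G \<and> R \<subseteq> N}) G"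
    by (rule subgroups_Inter) (use assms ne in \<open>auto simp: normal_imp_subgroup\<close>)
  then show ?thesis
    unfolding normal_closure_def
    by (auto simp: normal_inv_iff)
qed

lemma group_semidirect:
  assumes X: "group X" and Y: "group Y" and \<phi>: "\<phi> \<in> hom Y (AutoGroup X)"
  shows "group (semidirect X \<phi> Y)"
proof -
  interpret X: group X by fact
  interpret Y: group Y by fact
  have auto: "\<phi> y \<in> auto X" if "y \<in> carrier Y" for y
    using \<phi> that by (auto simp: hom_def AutoGroup_def)
  have closed: "\<phi> y x \<in> carrier X" if "y \<in> carrier Y" "x \<in> carrier X" for x y
    using auto[OF that(1)] that(2) by (auto simp: auto_def hom_def)
  have mult: "\<phi> y (x \<otimes>\<^bsub>X\<^esub> x') = \<phi> y x \<otimes>\<^bsub>X\<^esub> \<phi> y x'"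
    if "y \<in> carrier Y" "x \<in> carrier X" "x' \<in> carrier X" for x x' y
    using auto[OF that(1)] that(2,3) by (auto simp: auto_def hom_def)
  have comp: "\<phi> (y \<otimes>\<^bsub>Y\<^esub> y') x = \<phi> y (\<phi> y' x)"
    if "y \<in> carrier Y" "y' \<in> carrier Y" "x \<in> carrier X" for x y y'
  proof -
    have "\<phi> (y \<otimes>\<^bsub>Y\<^esub> y') = \<phi> y \<otimes>\<^bsub>AutoGroup X\<^esub> \<phi> y'"
      using \<phi> that by (simp add: hom_def)
    also have "\<dots> = compose (carrier X) (\<phi> y) (\<phi> y')"
      using auto that by (simp add: AutoGroup_def BijGroup_def auto_def)
    finally show ?thesis
      using that by (simp add: compose_eq)
  qed
  have "\<phi> \<one>\<^bsub>Y\<^esub> = \<one>\<^bsub>AutoGroup X\<^esub>"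
    using hom_one[OF \<phi> Y X.AutoGroup] .
  then have one: "\<phi> \<one>\<^bsub>Y\<^esub> x = x" if "x \<in> carrier X" for x
    using that by (simp add: AutoGroup_def BijGroup_def)
  show ?thesis
  proof (rule groupI)
    fix g assume "g \<in> carrier (semidirect X \<phi> Y)"
    then obtain x y where g: "g = (x, y)" "x \<in> carrier X" "y \<in> carrier Y"
      by (auto simp: semidirect_def)
    have "\<phi> (inv\<^bsub>Y\<^esub> y) (inv\<^bsub>X\<^esub> x) \<otimes>\<^bsub>X\<^esub> \<phi> (inv\<^bsub>Y\<^esub> y) x = \<phi> (inv\<^bsub>Y\<^esub> y) \<one>\<^bsub>X\<^esub>"
      using g by (simp flip: mult)
    also have "\<dots> = \<one>\<^bsub>X\<^esub>"
      using closed[of "inv\<^bsub>Y\<^esub> y" "\<one>\<^bsub>X\<^esub>"] mult[of "inv\<^bsub>Y\<^esub> y" "\<one>\<^bsub>X\<^esub>" "\<one>\<^bsub>X\<^esub>"] g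
      by (simp add: X.r_cancel_one')
    finally show "\<exists>h\<in>carrier (semidirect X \<phi> Y). h \<otimes>\<^bsub>semidirect X \<phi> Y\<^esub> g = \<one>\<^bsub>semidirect X \<phi> Y\<^esub>"
      using g closed[of "inv\<^bsub>Y\<^esub> y" "inv\<^bsub>X\<^esub> x"]
      by (intro bexI[of _ "(\<phi> (inv\<^bsub>Y\<^esub> y) (inv\<^bsub>X\<^esub> x), inv\<^bsub>Y\<^esub> y)"]) (auto simp: semidirect_def)
  qed (auto simp: semidirect_def closed mult comp one X.m_assoc Y.m_assoc)
qed

end

theory Submission
  imports Defs "HOL-Number_Theory.Residue_Primitive_Roots"
begin

text \<open>
  In \<open>G\<close> every element is uniquely \<open>a\<^sup>i b\<^sup>j\<close> with \<open>i\<close> modulo \<open>q\<^sup>2\<close> and \<open>j\<close> modulo \<open>p\<^sup>2\<close>; uniqueness is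
  read off from a homomorphism to a concrete semidirect product of cyclic groups
  (\<open>metacyclic_model\<close>, \<open>metacyclic_group_is_metacyclic\<close>). An endomorphism is determined by the
  images of \<open>a\<close> and \<open>b\<close>, and by the universal property of the presentation
  (\<open>presented_group_lift\<close>) any images that satisfy the relations are allowed.

  An automorphism must send \<open>b\<close> to \<open>b\<^sup>s\<close> with \<open>s\<close> a unit modulo \<open>p\<^sup>2\<close>, since only powers of \<open>b\<close> have
  order dividing \<open>p\<^sup>2\<close>, and \<open>a\<close> to some \<open>a\<^sup>t b\<^sup>u\<close>. Preserving the action of \<open>a\<close> on \<open>b\<close>, which has
  order \<open>q\<close>, forces \<open>t\<close> to be \<open>1 + q l\<close> (\<open>\<Psi>_surj\<close>). Conversely all such choices work (\<open>endo\<close>): the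
  order of \<open>r\<close> is prime to \<open>p\<close>, so \<open>1 + r + \<dots> + r\<^bsup>q-1\<^esup>\<close> vanishes modulo \<open>p\<^sup>2\<close>
  (\<open>geometric_sum_prime_square\<close>), whence \<open>(a\<^sup>t b\<^sup>u)\<^sup>q = a\<^bsup>tq\<^esup>\<close>.

  Writing units as powers of a primitive root \<open>g\<close> modulo \<open>p\<^sup>2\<close>, the automorphisms are therefore the
  triples \<open>(u, i, l)\<close> modulo \<open>p\<^sup>2\<close>, \<open>p (p - 1)\<close> and \<open>q\<close>. Because \<open>a\<^sup>q\<close> is central, they compose by
  \<open>(u, i, l)(u', i', l') = (u + g\<^sup>i u', i + i', l + l')\<close> (\<open>compose_endo\<close>, \<open>\<Psi>_mult\<close>), which is the
  asserted semidirect product with \<open>\<phi>\<close> acting through the first factor as multiplication by \<open>g\<^sup>i\<close>.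
\<close>

section \<open>Presented groups\<close>

fun word_value :: "('g, 'm) monoid_scheme \<Rightarrow> ('a \<Rightarrow> 'g) \<Rightarrow> 'a word \<Rightarrow> 'g"
  where
    "word_value H f [] = \<one>\<^bsub>H\<^esub>"
  | "word_value H f ((x, e) # w) =
      (if e then f x else inv\<^bsub>H\<^esub> f x) \<otimes>\<^bsub>H\<^esub> word_value H f w"

context group
begin

lemma word_value_closed:
  assumes "f \<in> S \<rightarrow> carrier G" "w \<in> words S"
  shows "word_value G f w \<in> carrier G"
  using assms(2) by (induction w) (use assms(1) in \<open>auto simp: Pi_iff\<close>)

lemma word_value_append:
  assumes f: "f \<in> S \<rightarrow> carrier G" and "u \<in> words S" "v \<in> words S"
  shows "word_value G f (u @ v) = word_value G f u \<otimes> word_value G f v"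
  using assms(2)
proof (induction u)
  case Nil
  show ?case using assms by (simp add: word_value_closed)
next
  case (Cons l u)
  then have "fst l \<in> S" by auto
  then have "f (fst l) \<in> carrier G" using f by auto
  then show ?case
    using Cons assms word_value_closed[OF f] by (cases l) (auto simp: m_assoc)
qed

lemma word_value_cancels:
  assumes f: "\<And>x. f x \<in> carrier G" and "cancels u v"
  shows "word_value G f u = word_value G f v"
  using assms(2)
proof cases
  case (1 u' x e v')
  have f': "f \<in> UNIV \<rightarrow> carrier G" using f by auto
  have "word_value G f ([(x, e), (x, \<not> e)] @ v') = word_value G f v'"
    using f word_value_closed[OF f'] by (cases e) (auto simp flip: m_assoc)
  then show ?thesis
    using 1 word_value_append[OF f'] by auto
qed

text \<open>
  Cancellations may pass through letters outside the alphabet; sending those to the unit makes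
  every intermediate word have a value in the group.
\<close>

lemma word_value_free_rel:
  assumes f: "f \<in> S \<rightarrow> carrier G" and "(u, v) \<in> free_rel S"
  shows "word_value G f u = word_value G f v"
proof -
  define f' where "f' x = (if x \<in> S then f x else \<one>)" for x
  have f': "f' x \<in> carrier G" for x using f by (auto simp: f'_def)
  have same: "word_value G f' w = word_value G f w" if "w \<in> words S" for w
    using that by (induction w) (auto simp: f'_def)
  have "equivclp cancels u v" and S: "u \<in> words S" "v \<in> words S"
    using assms(2) by (auto simp: free_rel_def)
  from this(1) have "word_value G f' u = word_value G f' v"
  proof (induction rule: equivclp_induct)
    case (step y z)
    then show ?case
      using word_value_cancels[OF f', where u = y and v = z]
        word_value_cancels[OF f', where u = z and v = y] by auto
  qed simp
  then show ?thesis using same S by simp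
qed

theorem free_group_lift:
  assumes f: "f \<in> S \<rightarrow> carrier G"
  shows "\<exists>h\<in>hom (free_group S) G. \<forall>x\<in>S. h (free_gen S x) = f x"
proof -
  define h where "h U = word_value G f (SOME u. u \<in> U)" for U
  have h: "h (free_rel S `` {u}) = word_value G f u" if "u \<in> words S" for u
  proof -
    have "u \<in> free_rel S `` {u}"
      using that by (simp add: free_rel_def)
    then have "(SOME v. v \<in> free_rel S `` {u}) \<in> free_rel S `` {u}"
      by (rule someI)
    then show ?thesis
      unfolding h_def using word_value_free_rel[OF f] by auto
  qed
  have "h \<in> hom (free_group S) G"
  proof (rule homI)
    fix U V assume "U \<in> carrier (free_group S)" "V \<in> carrier (free_group S)"
    then obtain u v where uv: "u \<in> words S" "v \<in> words S"
        "U = free_rel S `` {u}" "V = free_rel S `` {v}"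
      by (auto simp: free_group_def elim!: quotientE)
    then show "h (U \<otimes>\<^bsub>free_group S\<^esub> V) = h U \<otimes> h V" "h U \<in> carrier G"
      using f by (auto simp: free_group_mult_class h word_value_append word_value_closed)
  qed
  moreover have "h (free_gen S x) = f x" if "x \<in> S" for x
    using that f by (auto simp: free_gen_def h Pi_iff)
  ultimately show ?thesis by blast
qed

end

lemma free_gen_closed: "x \<in> S \<Longrightarrow> free_gen S x \<in> carrier (free_group S)"
  by (simp add: free_gen_def free_group_def quotientI)

lemma inv_free_gen:
  assumes "x \<in> S"
  shows "inv\<^bsub>free_group S\<^esub> free_gen S x = free_rel S `` {[(x, False)]}"
proof (rule group.inv_equality[OF group_free_group])
  have "([(x, False), (x, True)], []) \<in> free_rel S"
    using assms cancels.intros[of "[]" x False "[]"]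
    by (auto simp: free_rel_def intro: r_into_equivclp)
  then show "free_rel S `` {[(x, False)]} \<otimes>\<^bsub>free_group S\<^esub> free_gen S x = \<one>\<^bsub>free_group S\<^esub>"
    using assms equiv_class_eq[OF equiv_free_rel] unfolding free_gen_def
    by (subst free_group_mult_class) (auto simp: free_group_def)
qed (use assms free_gen_closed[OF assms] in \<open>auto simp: free_group_def quotientI\<close>)

lemma free_group_induct [consumes 1, case_names one gen inv_gen]:
  assumes "g \<in> carrier (free_group S)"
    and one: "P \<one>\<^bsub>free_group S\<^esub>"
    and gen: "\<And>x g. x \<in> S \<Longrightarrow> g \<in> carrier (free_group S) \<Longrightarrow> P g \<Longrightarrow>
        P (free_gen S x \<otimes>\<^bsub>free_group S\<^esub> g)"
    and inv_gen: "\<And>x g. x \<in> S \<Longrightarrow> g \<in> carrier (free_group S) \<Longrightarrow> P g \<Longrightarrow>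
        P (inv\<^bsub>free_group S\<^esub> free_gen S x \<otimes>\<^bsub>free_group S\<^esub> g)"
  shows "P g"
proof -
  have "P (free_rel S `` {w})" if "w \<in> words S" for w
    using that
  proof (induction w)
    case Nil
    show ?case using one by (simp add: free_group_def)
  next
    case (Cons l w)
    obtain x e where l: "l = (x, e)" by (cases l)
    have w: "w \<in> words S" "free_rel S `` {w} \<in> carrier (free_group S)" and x: "x \<in> S"
      using Cons l by (auto simp: free_group_def quotientI)
    show ?case
    proof (cases e)
      case True
      then show ?thesis
        using gen[OF x w(2) Cons.IH] w x l free_group_mult_class[of "[(x, True)]" S w]
        by (simp add: free_gen_def)
    next
      case False
      then show ?thesis
        using inv_gen[OF x w(2) Cons.IH] w x l free_group_mult_class[of "[(x, False)]" S w]
        by (simp add: inv_free_gen)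
    qed
  qed
  then show ?thesis
    using assms(1) by (auto simp: free_group_def elim!: quotientE)
qed

definition presented_gen :: "'a set \<Rightarrow> 'a word set set \<Rightarrow> 'a \<Rightarrow> 'a word set set"
  where "presented_gen S R x =
    normal_closure (free_group S) R #>\<^bsub>free_group S\<^esub> free_gen S x"

context
  fixes S :: "'a set" and R
  assumes R: "R \<subseteq> carrier (free_group S)"
begin

lemma normal_closure_normal: "normal_closure (free_group S) R \<lhd> free_group S"
  using group.normal_normal_closure[OF group_free_group R] .

lemma group_presented_group: "group (presented_group S R)"
  unfolding presented_group_def
  using normal.factorgroup_is_group[OF normal_closure_normal] .

lemma proj_hom:
  "(\<lambda>g. normal_closure (free_group S) R #>\<^bsub>free_group S\<^esub> g) \<in> hom (free_group S) (presented_group S R)"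
  unfolding presented_group_def using normal.r_coset_hom_Mod[OF normal_closure_normal] .

lemma presented_gen_closed: "x \<in> S \<Longrightarrow> presented_gen S R x \<in> carrier (presented_group S R)"
  unfolding presented_gen_def using proj_hom free_gen_closed[of x S] by (auto simp: hom_def)

lemma presented_group_relator:
  assumes "g \<in> R"
  shows "normal_closure (free_group S) R #>\<^bsub>free_group S\<^esub> g = \<one>\<^bsub>presented_group S R\<^esub>"
proof -
  have "g \<in> normal_closure (free_group S) R"
    using assms by (auto simp: normal_closure_def)
  then show ?thesis
    unfolding presented_group_def FactGroup_def
    using group.coset_join2[OF group_free_group] normal_imp_subgroup[OF normal_closure_normal]
      assms R by auto
qed

text \<open>
  A presented group is generated by the images of the letters, so induction may build elements by
  multiplying a generator or its inverse on the left.
\<close>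

lemma presented_group_induct [consumes 1, case_names one gen inv_gen]:
  assumes "g \<in> carrier (presented_group S R)"
    and one: "P \<one>\<^bsub>presented_group S R\<^esub>"
    and gen: "\<And>x g. x \<in> S \<Longrightarrow> g \<in> carrier (presented_group S R) \<Longrightarrow> P g \<Longrightarrow>
        P (presented_gen S R x \<otimes>\<^bsub>presented_group S R\<^esub> g)"
    and inv_gen: "\<And>x g. x \<in> S \<Longrightarrow> g \<in> carrier (presented_group S R) \<Longrightarrow> P g \<Longrightarrow>
        P (inv\<^bsub>presented_group S R\<^esub> presented_gen S R x \<otimes>\<^bsub>presented_group S R\<^esub> g)"
  shows "P g"
proof -
  let ?\<pi> = "\<lambda>g. normal_closure (free_group S) R #>\<^bsub>free_group S\<^esub> g"
  interpret \<pi>: group_hom "free_group S" "presented_group S R" ?\<pi>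
    using proj_hom group_free_group group_presented_group by (rule_tac group_hom.intro) (auto simp: group_hom_axioms_def)
  have "P (?\<pi> h)" if "h \<in> carrier (free_group S)" for h
    using that
  proof (induction rule: free_group_induct)
    case one
    show ?case using \<open>P \<one>\<^bsub>presented_group S R\<^esub>\<close> \<pi>.hom_one by simp
  next
    case (gen x g)
    then show ?case
      using assms(3)[of x "?\<pi> g"] \<pi>.hom_closed[of g] free_gen_closed[of x S]
      by (simp add: presented_gen_def)
  next
    case (inv_gen x g)
    then show ?case
      using assms(4)[of x "?\<pi> g"] \<pi>.hom_closed[of g] free_gen_closed[of x S]
      by (simp add: presented_gen_def)
  qed
  moreover obtain h where "h \<in> carrier (free_group S)" "g = ?\<pi> h"
    using assms(1) by (auto simp: presented_group_def carrier_FactGroup)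
  ultimately show ?thesis by simp
qed

text \<open>
  The universal property of a presentation. The condition on relators quantifies over
  homomorphisms \<open>h\<close> on the free group so that a relator given as a group expression
  can be evaluated by the homomorphism laws, without choosing a word for it.
\<close>

theorem presented_group_lift:
  assumes H: "group H" and f: "f \<in> S \<rightarrow> carrier H"
    and rel: "\<And>h g. h \<in> hom (free_group S) H \<Longrightarrow> \<forall>x\<in>S. h (free_gen S x) = f x \<Longrightarrow>
        g \<in> R \<Longrightarrow> h g = \<one>\<^bsub>H\<^esub>"
  shows "\<exists>h\<in>hom (presented_group S R) H. \<forall>x\<in>S. h (presented_gen S R x) = f x"
proof -
  obtain h where h: "h \<in> hom (free_group S) H" "\<forall>x\<in>S. h (free_gen S x) = f x"
    using group.free_group_lift[OF H f] by blast
  interpret h: group_hom "free_group S" H h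
    using h H group_free_group by (simp add: group_hom_def group_hom_axioms_def)
  have "normal_closure (free_group S) R \<subseteq> kernel (free_group S) H h"
    using h.normal_kernel rel[OF h] R by (auto simp: normal_closure_def kernel_def)
  from h.FactGroup_universal_kernel[OF normal_closure_normal this]
  obtain k where "k \<in> hom (presented_group S R) H"
      "\<And>x. x \<in> carrier (free_group S) \<Longrightarrow>
        k (normal_closure (free_group S) R #>\<^bsub>free_group S\<^esub> x) = h x"
    unfolding presented_group_def by blast
  with h show ?thesis
    by (intro bexI[of _ k]) (auto simp: presented_gen_def free_gen_closed)
qed

end

section \<open>Metacyclic groups and their normal forms\<close>

lemma power_cong_exponent:
  fixes c n :: nat
  assumes "[c ^ m = 1] (mod n)" "[i = j] (mod m)"
  shows "[c ^ i = c ^ j] (mod n)"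
proof -
  have red: "[c ^ k = c ^ (k mod m)] (mod n)" for k
  proof -
    have "c ^ k = (c ^ m) ^ (k div m) * c ^ (k mod m)"
      by (simp flip: power_mult power_add)
    moreover have "[(c ^ m) ^ (k div m) * c ^ (k mod m) = 1 ^ (k div m) * c ^ (k mod m)] (mod n)"
      by (intro cong_mult cong_pow assms cong_refl)
    ultimately show ?thesis by simp
  qed
  have "i mod m = j mod m" using assms(2) by (simp add: cong_def)
  then show ?thesis
    using red[of i] red[of j] cong_sym cong_trans by metis
qed

text \<open>
  The exponent \<open>k\<close> ranges over residues represented by nonnegative integers, which is why
  \<open>nat\<close> loses nothing. The restriction to the carrier is needed because the elements of
  \<open>AutoGroup\<close> are extensional functions.
\<close>

definition mult_action :: "nat \<Rightarrow> nat \<Rightarrow> int \<Rightarrow> int \<Rightarrow> int"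
  where "mult_action n c k =
    (\<lambda>x\<in>carrier (integer_mod_group n). (int (c ^ nat k) * x) mod int n)"

text \<open>
  Exponents may be reduced modulo \<open>m\<close> because \<open>c\<^sup>m\<close> is 1 modulo \<open>n\<close>; hence the maps compose
  additively in the exponent, and the map for \<open>-k\<close> inverts the one for \<open>k\<close>.
\<close>

lemma mult_action_hom:
  assumes n: "n > 0" and m: "m > 0" and c: "[c ^ m = 1] (mod n)"
  shows "mult_action n c \<in> hom (integer_mod_group m) (AutoGroup (integer_mod_group n))"
proof -
  let ?Z = "integer_mod_group n"
  have closed: "mult_action n c k x \<in> carrier ?Z" if "x \<in> carrier ?Z" for k x
    using that n by (simp add: mult_action_def carrier_integer_mod_group)
  have comp: "mult_action n c k (mult_action n c l x) = mult_action n c ((k + l) mod int m) x"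
    if "k \<ge> 0" "l \<ge> 0" "x \<in> carrier ?Z" for k l x
  proof -
    have "nat ((k + l) mod int m) = (nat k + nat l) mod m"
      using that by (simp add: nat_mod_distrib nat_add_distrib)
    then have "[c ^ nat ((k + l) mod int m) = c ^ (nat k + nat l)] (mod n)"
      using power_cong_exponent[OF c] by simp
    then have "[int (c ^ nat ((k + l) mod int m)) * x = int (c ^ (nat k + nat l)) * x] (mod int n)"
      by (intro cong_mult cong_refl) (simp only: cong_int_iff)
    moreover have "mult_action n c k (mult_action n c l x)
        = (int (c ^ nat k) * (int (c ^ nat l) * x)) mod int n"
      using closed[OF that(3), of l] that(3)
      by (simp add: mult_action_def mod_mult_right_eq)
    ultimately show ?thesis
      using that(3) by (simp add: mult_action_def cong_def power_add mult_ac)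
  qed
  have zero: "mult_action n c 0 x = x" if "x \<in> carrier ?Z" for x
    using that n by (simp add: mult_action_def carrier_integer_mod_group)
  have bij: "bij_betw (mult_action n c k) (carrier ?Z) (carrier ?Z)" if "k \<in> carrier (integer_mod_group m)" for k
  proof (rule bij_betw_byWitness[where f' = "mult_action n c ((- k) mod int m)"])
    have k: "k \<ge> 0" "(- k) mod int m \<ge> 0" using that m by (auto simp: carrier_integer_mod_group)
    have k0: "((- k) mod int m + k) mod int m = 0" "(k + (- k) mod int m) mod int m = 0"
      by (simp_all add: mod_add_left_eq mod_add_right_eq)
    show "\<forall>x\<in>carrier ?Z. mult_action n c (- k mod int m) (mult_action n c k x) = x"
      using comp[of "(- k) mod int m" k] k k0 zero by auto
    show "\<forall>x\<in>carrier ?Z. mult_action n c k (mult_action n c (- k mod int m) x) = x"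
      using comp[of k "(- k) mod int m"] k k0 zero by auto
  qed (auto simp: closed)
  have auto: "mult_action n c k \<in> auto ?Z" if "k \<in> carrier (integer_mod_group m)" for k
  proof -
    have "mult_action n c k \<in> hom ?Z ?Z"
    proof (rule homI)
      fix x y assume xy: "x \<in> carrier ?Z" "y \<in> carrier ?Z"
      then have "(x + y) mod int n \<in> carrier ?Z" using n by (simp add: carrier_integer_mod_group)
      with xy show "mult_action n c k (x \<otimes>\<^bsub>?Z\<^esub> y) = mult_action n c k x \<otimes>\<^bsub>?Z\<^esub> mult_action n c k y"
        by (simp add: mult_action_def mod_simps distrib_left)
    qed (rule closed)
    moreover have "mult_action n c k \<in> extensional (carrier ?Z)"
      by (simp add: mult_action_def)
    ultimately show ?thesis using bij[OF that] by (simp add: auto_def Bij_def)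
  qed
  show ?thesis
  proof (rule homI)
    fix k assume "k \<in> carrier (integer_mod_group m)"
    then show "mult_action n c k \<in> carrier (AutoGroup ?Z)"
      using auto by (simp add: AutoGroup_def)
  next
    fix k l assume kl: "k \<in> carrier (integer_mod_group m)" "l \<in> carrier (integer_mod_group m)"
    then have "mult_action n c k \<otimes>\<^bsub>AutoGroup ?Z\<^esub> mult_action n c l
        = compose (carrier ?Z) (mult_action n c k) (mult_action n c l)"
      using auto by (simp add: AutoGroup_def BijGroup_def auto_def)
    also have "\<dots> = mult_action n c ((k + l) mod int m)"
    proof (rule extensionalityI[of _ "carrier ?Z"])
      show "mult_action n c ((k + l) mod int m) \<in> extensional (carrier ?Z)"
        by (simp add: mult_action_def)
    qed (use kl m comp[of k l] in \<open>auto simp: compose_def carrier_integer_mod_group\<close>)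
    finally show "mult_action n c (k \<otimes>\<^bsub>integer_mod_group m\<^esub> l)
        = mult_action n c k \<otimes>\<^bsub>AutoGroup ?Z\<^esub> mult_action n c l"
      by simp
  qed
qed

context group
begin

lemma nat_pow_cong:
  fixes i j :: nat
  assumes "x \<in> carrier G" "x [^] m = \<one>" "[i = j] (mod m)"
  shows "x [^] i = x [^] j"
proof -
  have red: "x [^] k = x [^] (k mod m)" for k
  proof -
    have "x [^] k = x [^] (m * (k div m) + k mod m)" by simp
    also have "\<dots> = (x [^] m) [^] (k div m) \<otimes> x [^] (k mod m)"
      using assms(1) by (simp only: nat_pow_mult nat_pow_pow nat_pow_closed)
    finally show ?thesis using assms(1,2) by simp
  qed
  show ?thesis using red[of i] red[of j] assms(3) by (simp add: cong_def)
qed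

lemma int_pow_cong_nat:
  assumes "x \<in> carrier G" "x [^] n = \<one>" "[r = int k] (mod int n)"
  shows "x [^] r = x [^] k"
proof -
  have "ord x dvd n" using assms pow_eq_id by blast
  then have "int (ord x) dvd int k - r"
    using assms(3) by (meson cong_iff_dvd_diff cong_sym dvd_trans int_dvd_int_iff)
  then have "x [^] r = x [^] int k"
    using int_pow_eq assms(1) by blast
  then show ?thesis by (simp add: int_pow_int)
qed

lemma pow_swap:
  fixes i j k :: nat
  assumes x: "x \<in> carrier G" "y \<in> carrier G" and xy: "y \<otimes> x = x \<otimes> y [^] k"
  shows "y [^] j \<otimes> x [^] i = x [^] i \<otimes> y [^] (j * k ^ i)"
proof -
  have one: "y [^] j \<otimes> x = x \<otimes> y [^] (j * k)" for j
  proof (induction j)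
    case (Suc j)
    have "y [^] Suc j \<otimes> x = y [^] j \<otimes> (x \<otimes> y [^] k)"
      using x by (simp add: m_assoc xy)
    also have "\<dots> = (y [^] j \<otimes> x) \<otimes> y [^] k"
      using x by (simp add: m_assoc)
    also have "\<dots> = x \<otimes> y [^] (Suc j * k)"
      using x by (simp add: Suc.IH m_assoc nat_pow_mult add.commute)
    finally show ?case .
  qed (use x in simp)
  show ?thesis
  proof (induction i)
    case (Suc i)
    have "y [^] j \<otimes> x [^] Suc i = (y [^] j \<otimes> x [^] i) \<otimes> x"
      using x by (simp add: m_assoc)
    also have "\<dots> = x [^] i \<otimes> (y [^] (j * k ^ i) \<otimes> x)"
      using x by (simp add: Suc.IH m_assoc)
    also have "\<dots> = x [^] Suc i \<otimes> y [^] (j * k ^ Suc i)"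
      using x by (simp add: one m_assoc[symmetric] mult_ac)
    finally show ?case .
  qed (use x in simp)
qed

end

text \<open>
  This interface isolates what the presentation yields: relations, normal forms \<open>a\<^sup>i b\<^sup>j\<close>, their
  uniqueness, and the universal property for maps of the group into itself. Restricting the
  latter to endomorphisms avoids quantifying over the type of the target group, which a locale
  assumption cannot do.
\<close>

locale metacyclic = group G for G (structure) +
  fixes a b and m n k :: nat
  assumes a_closed [simp, intro]: "a \<in> carrier G"
    and b_closed [simp, intro]: "b \<in> carrier G"
    and a_pow: "a [^] m = \<one>"
    and b_pow: "b [^] n = \<one>"
    and swap: "b \<otimes> a = a \<otimes> b [^] k"
    and normal_form: "x \<in> carrier G \<Longrightarrow> \<exists>(i :: nat) (j :: nat). x = a [^] i \<otimes> b [^] j"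
    and normal_form_unique: "a [^] i \<otimes> b [^] j = a [^] i' \<otimes> b [^] j' \<Longrightarrow>
      [i = i'] (mod m) \<and> [j = j'] (mod n)"
    and extend: "\<lbrakk>x \<in> carrier G; y \<in> carrier G; x [^] m = \<one>; y [^] n = \<one>; y \<otimes> x = x \<otimes> y [^] k\<rbrakk> \<Longrightarrow>
      \<exists>h\<in>hom G G. h a = x \<and> h b = y"

text \<open>
  Normal forms in the presented group could collapse; a concrete group that satisfies the
  relations and has pairwise distinct normal forms shows that they do not. The model is the
  semidirect product of the residues modulo \<open>n\<close> by those modulo \<open>m\<close>.
\<close>

lemma metacyclic_model:
  fixes m n k :: nat
  assumes m: "m > 0" and n: "n > 0" and k: "[k ^ m = 1] (mod n)"
  shows "\<exists>H :: (int \<times> int) monoid. group H \<and> (\<exists>x\<in>carrier H. \<exists>y\<in>carrier H.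
    x [^]\<^bsub>H\<^esub> m = \<one>\<^bsub>H\<^esub> \<and> y [^]\<^bsub>H\<^esub> n = \<one>\<^bsub>H\<^esub> \<and> y \<otimes>\<^bsub>H\<^esub> x = x \<otimes>\<^bsub>H\<^esub> y [^]\<^bsub>H\<^esub> k \<and>
    (\<forall>i j i' j'. x [^]\<^bsub>H\<^esub> i \<otimes>\<^bsub>H\<^esub> y [^]\<^bsub>H\<^esub> j = x [^]\<^bsub>H\<^esub> i' \<otimes>\<^bsub>H\<^esub> y [^]\<^bsub>H\<^esub> j' \<longrightarrow>
      [i = i'] (mod m) \<and> [j = j'] (mod n)))"
proof -
  \<comment> \<open>In a semidirect product x acts by conjugation from the left, whereas the relation
    prescribes conjugation from the right; hence x acts by the inverse of k.\<close>
  define c where "c = k ^ (m - 1)"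
  have kc: "[c * k = 1] (mod n)"
    using k m by (simp add: c_def power_eq_if mult.commute)
  have cm: "[c ^ m = 1] (mod n)"
    using cong_pow[OF k, of "m - 1"] by (simp add: c_def mult.commute flip: power_mult)
  have "coprime c n"
    using kc coprime_iff_invertible_nat by auto
  then have cop: "coprime (c ^ i) n" for i by simp
  let ?H = "semidirect (integer_mod_group n) (mult_action n c) (integer_mod_group m)"
  define x y where "x = (0 :: int, 1 mod int m)" and "y = (1 mod int n, 0 :: int)"
  interpret H: group ?H
    by (rule group_semidirect) (use mult_action_hom[OF n m cm] in auto)
  have xy: "x \<in> carrier ?H" "y \<in> carrier ?H"
    using m n by (auto simp: x_def y_def semidirect_def carrier_integer_mod_group)
  have act: "mult_action n c l (z mod int n) = (int (c ^ nat l) * z) mod int n" for l z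
    using n by (simp add: mult_action_def carrier_integer_mod_group mod_mult_right_eq)
  have mult: "(z mod int n, w) \<otimes>\<^bsub>?H\<^esub> (z' mod int n, w') =
      ((z + int (c ^ nat w) * z') mod int n, (w + w') mod int m)" for z z' w w'
    by (simp add: semidirect_def act mod_simps)
  have one: "\<one>\<^bsub>?H\<^esub> = (0, 0)" by (simp add: semidirect_def)
  have xp: "x [^]\<^bsub>?H\<^esub> i = (0, int i mod int m)" for i :: nat
  proof (induction i)
    case (Suc i)
    then show ?case
      using mult[of 0 "int i mod int m" 0 "1 mod int m"] by (simp add: x_def mod_simps add.commute)
  qed (simp add: one)
  have yp: "y [^]\<^bsub>?H\<^esub> j = (int j mod int n, 0)" for j :: nat
  proof (induction j)
    case (Suc j)
    then show ?case
      using mult[of "int j" 0 1 0] by (simp add: y_def add.commute)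
  qed (simp add: one)
  have nf: "x [^]\<^bsub>?H\<^esub> i \<otimes>\<^bsub>?H\<^esub> y [^]\<^bsub>?H\<^esub> j = (int (c ^ (i mod m) * j) mod int n, int i mod int m)" for i j :: nat
    using mult[of 0 "int i mod int m" "int j" 0] by (simp add: xp yp nat_mod_distrib)
  have "y \<otimes>\<^bsub>?H\<^esub> x = x \<otimes>\<^bsub>?H\<^esub> y [^]\<^bsub>?H\<^esub> k"
  proof -
    have "[c ^ (1 mod m) = c ^ 1] (mod n)"
      by (rule power_cong_exponent[OF cm]) simp
    then have "[c ^ (1 mod m) * k = c ^ 1 * k] (mod n)"
      by (rule cong_mult[OF _ cong_refl])
    from cong_trans[OF this[unfolded power_one_right] kc]
    have "[c ^ (1 mod m) * k = 1] (mod n)" .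
    then have "int (c ^ (1 mod m) * k) mod int n = 1 mod int n"
      by (metis cong_def of_nat_1 of_nat_mod)
    moreover have "x \<otimes>\<^bsub>?H\<^esub> y [^]\<^bsub>?H\<^esub> k = x [^]\<^bsub>?H\<^esub> (1::nat) \<otimes>\<^bsub>?H\<^esub> y [^]\<^bsub>?H\<^esub> k"
      using xy by simp
    moreover have "y \<otimes>\<^bsub>?H\<^esub> x = (1 mod int n, 1 mod int m)"
      using mult[of 1 0 0 "1 mod int m"] by (simp add: x_def y_def)
    ultimately show ?thesis
      unfolding nf by simp
  qed
  moreover have "[i = i'] (mod m) \<and> [j = j'] (mod n)"
    if "x [^]\<^bsub>?H\<^esub> i \<otimes>\<^bsub>?H\<^esub> y [^]\<^bsub>?H\<^esub> j = x [^]\<^bsub>?H\<^esub> i' \<otimes>\<^bsub>?H\<^esub> y [^]\<^bsub>?H\<^esub> j'" for i j i' j' :: nat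
  proof -
    from that have "int i mod int m = int i' mod int m"
        "int (c ^ (i mod m) * j) mod int n = int (c ^ (i' mod m) * j') mod int n"
      unfolding nf by blast+
    then have "i mod m = i' mod m" "[c ^ (i mod m) * j = c ^ (i' mod m) * j'] (mod n)"
      by (simp_all only: cong_def of_nat_eq_iff flip: of_nat_mod)
    then show ?thesis
      using cong_mult_lcancel_nat[OF cop] by (simp add: cong_def)
  qed
  moreover have "x [^]\<^bsub>?H\<^esub> m = \<one>\<^bsub>?H\<^esub>" "y [^]\<^bsub>?H\<^esub> n = \<one>\<^bsub>?H\<^esub>"
    by (simp_all add: xp yp one)
  ultimately show ?thesis
    using H.group_axioms xy by blast
qed


lemma metacyclic_group_relators_closed:
  fixes m n :: nat
  defines "F \<equiv> free_group {A, B}" and "x \<equiv> free_gen {A, B} A" and "y \<equiv> free_gen {A, B} B"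
  shows "{x [^]\<^bsub>F\<^esub> m, y [^]\<^bsub>F\<^esub> n,
    inv\<^bsub>F\<^esub> x \<otimes>\<^bsub>F\<^esub> y \<otimes>\<^bsub>F\<^esub> x \<otimes>\<^bsub>F\<^esub> inv\<^bsub>F\<^esub> (y [^]\<^bsub>F\<^esub> (r :: int))} \<subseteq> carrier F"
proof -
  interpret F: group F unfolding F_def by (rule group_free_group)
  have "x \<in> carrier F" "y \<in> carrier F"
    by (simp_all add: F_def x_def y_def free_gen_closed)
  then show ?thesis by simp
qed

text \<open>
  Existence of normal forms is an induction over generators: \<open>pow_swap\<close> moves powers of \<open>b\<close> past
  powers of \<open>a\<close>, and inverses are positive powers. Uniqueness is inherited from the model through
  the universal property.
\<close>

theorem metacyclic_group_is_metacyclic: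
  fixes m n k :: nat and r :: int
  assumes m: "m > 0" and n: "n > 0" and k: "[k ^ m = 1] (mod n)" and r: "[r = int k] (mod int n)"
  shows "\<exists>a b. metacyclic (metacyclic_group m n r) a b m n k"
proof -
  let ?S = "{A, B}"
  define F where "F = free_group ?S"
  define x y where "x = free_gen ?S A" and "y = free_gen ?S B"
  define rel where "rel = inv\<^bsub>F\<^esub> x \<otimes>\<^bsub>F\<^esub> y \<otimes>\<^bsub>F\<^esub> x \<otimes>\<^bsub>F\<^esub> inv\<^bsub>F\<^esub> (y [^]\<^bsub>F\<^esub> r)"
  define R where "R = {x [^]\<^bsub>F\<^esub> m, y [^]\<^bsub>F\<^esub> n, rel}"
  define G where "G = metacyclic_group m n r"
  have G: "G = presented_group ?S R"
    by (simp add: G_def metacyclic_group_def R_def rel_def F_def x_def y_def Let_def)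
  have R: "R \<subseteq> carrier (free_group ?S)"
    using metacyclic_group_relators_closed unfolding R_def rel_def F_def x_def y_def .
  interpret F: group F unfolding F_def by (rule group_free_group)
  interpret G: group G unfolding G by (rule group_presented_group[OF R])
  have xy: "x \<in> carrier F" "y \<in> carrier F"
    by (simp_all add: F_def x_def y_def free_gen_closed)
  have relator_iff: "h (x [^]\<^bsub>F\<^esub> m) = h x [^]\<^bsub>H\<^esub> m" "h (y [^]\<^bsub>F\<^esub> n) = h y [^]\<^bsub>H\<^esub> n"
    "h y [^]\<^bsub>H\<^esub> n = \<one>\<^bsub>H\<^esub> \<Longrightarrow> h rel = \<one>\<^bsub>H\<^esub> \<longleftrightarrow> h y \<otimes>\<^bsub>H\<^esub> h x = h x \<otimes>\<^bsub>H\<^esub> h y [^]\<^bsub>H\<^esub> k"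
    if "group H" "h \<in> hom F H" for H :: "('h, 'm) monoid_scheme" and h
  proof -
    interpret h: group_hom F H h
      using that F.group_axioms by (simp add: group_hom_def group_hom_axioms_def)
    have hc: "h x \<in> carrier H" "h y \<in> carrier H" using xy by simp_all
    show "h (x [^]\<^bsub>F\<^esub> m) = h x [^]\<^bsub>H\<^esub> m" "h (y [^]\<^bsub>F\<^esub> n) = h y [^]\<^bsub>H\<^esub> n"
      using xy by (simp_all add: h.hom_nat_pow)
    assume "h y [^]\<^bsub>H\<^esub> n = \<one>\<^bsub>H\<^esub>"
    then have yr: "h y [^]\<^bsub>H\<^esub> r = h y [^]\<^bsub>H\<^esub> k"
      using h.int_pow_cong_nat hc r by blast
    have "h rel = inv\<^bsub>H\<^esub> h x \<otimes>\<^bsub>H\<^esub> h y \<otimes>\<^bsub>H\<^esub> h x \<otimes>\<^bsub>H\<^esub> inv\<^bsub>H\<^esub> (h y [^]\<^bsub>H\<^esub> k)"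
      using xy by (simp add: rel_def h.hom_int_pow yr)
    also have "\<dots> = \<one>\<^bsub>H\<^esub> \<longleftrightarrow> inv\<^bsub>H\<^esub> h x \<otimes>\<^bsub>H\<^esub> (h y \<otimes>\<^bsub>H\<^esub> h x) = h y [^]\<^bsub>H\<^esub> k"
      using hc h.H.inv_solve_right'[of \<open>\<one>\<^bsub>H\<^esub>\<close> \<open>inv\<^bsub>H\<^esub> h x \<otimes>\<^bsub>H\<^esub> (h y \<otimes>\<^bsub>H\<^esub> h x)\<close> \<open>h y [^]\<^bsub>H\<^esub> k\<close>]
      by (simp add: h.H.m_assoc)
    also have "\<dots> \<longleftrightarrow> h y \<otimes>\<^bsub>H\<^esub> h x = h x \<otimes>\<^bsub>H\<^esub> h y [^]\<^bsub>H\<^esub> k"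
      using hc by (intro h.H.inv_solve_left') simp_all
    finally show "h rel = \<one>\<^bsub>H\<^esub> \<longleftrightarrow> h y \<otimes>\<^bsub>H\<^esub> h x = h x \<otimes>\<^bsub>H\<^esub> h y [^]\<^bsub>H\<^esub> k" .
  qed
  define a b where "a = presented_gen ?S R A" and "b = presented_gen ?S R B"
  have ab: "a \<in> carrier G" "b \<in> carrier G"
    by (simp_all add: a_def b_def G presented_gen_closed[OF R])
  have lift: "\<exists>h\<in>hom G H. h a = u \<and> h b = v"
    if H: "group H" and uv: "u \<in> carrier H" "v \<in> carrier H" "u [^]\<^bsub>H\<^esub> m = \<one>\<^bsub>H\<^esub>" "v [^]\<^bsub>H\<^esub> n = \<one>\<^bsub>H\<^esub>"
      "v \<otimes>\<^bsub>H\<^esub> u = u \<otimes>\<^bsub>H\<^esub> v [^]\<^bsub>H\<^esub> k" for H :: "('h, 'm) monoid_scheme" and u v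
  proof -
    let ?f = "\<lambda>l. case l of A \<Rightarrow> u | B \<Rightarrow> v"
    have "\<exists>h\<in>hom (presented_group ?S R) H. \<forall>l\<in>?S. h (presented_gen ?S R l) = ?f l"
    proof (rule presented_group_lift[OF R H])
      show "?f \<in> ?S \<rightarrow> carrier H" using uv by auto
      fix h g assume h: "h \<in> hom (free_group ?S) H" "\<forall>l\<in>?S. h (free_gen ?S l) = ?f l" and g: "g \<in> R"
      then have "h x = u" "h y = v" by (simp_all add: x_def y_def)
      with relator_iff[OF H h(1)[folded F_def]] g uv show "h g = \<one>\<^bsub>H\<^esub>"
        by (auto simp: R_def)
    qed
    then show ?thesis by (auto simp: G a_def b_def)
  qed
  define \<pi> where "\<pi> g = normal_closure F R #>\<^bsub>F\<^esub> g" for g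
  have \<pi>: "\<pi> \<in> hom F G"
    using proj_hom[OF R] unfolding F_def G \<pi>_def .
  have \<pi>_rel: "\<pi> g = \<one>\<^bsub>G\<^esub>" if "g \<in> R" for g
    using presented_group_relator[OF R that] unfolding F_def G \<pi>_def .
  have \<pi>_gen: "\<pi> x = a" "\<pi> y = b"
    by (simp_all add: \<pi>_def a_def b_def x_def y_def presented_gen_def F_def)
  have am: "a [^]\<^bsub>G\<^esub> m = \<one>\<^bsub>G\<^esub>" and bn: "b [^]\<^bsub>G\<^esub> n = \<one>\<^bsub>G\<^esub>"
    using relator_iff(1,2)[OF G.group_axioms \<pi>] \<pi>_rel by (auto simp: \<pi>_gen R_def)
  then have ba: "b \<otimes>\<^bsub>G\<^esub> a = a \<otimes>\<^bsub>G\<^esub> b [^]\<^bsub>G\<^esub> k"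
    using relator_iff(3)[OF G.group_axioms \<pi>] \<pi>_rel by (auto simp: \<pi>_gen R_def)
  have inv: "inv\<^bsub>G\<^esub> a = a [^]\<^bsub>G\<^esub> (m - 1)" "inv\<^bsub>G\<^esub> b = b [^]\<^bsub>G\<^esub> (n - 1)"
  proof -
    have "a [^]\<^bsub>G\<^esub> (m - 1) \<otimes>\<^bsub>G\<^esub> a = \<one>\<^bsub>G\<^esub>" "b [^]\<^bsub>G\<^esub> (n - 1) \<otimes>\<^bsub>G\<^esub> b = \<one>\<^bsub>G\<^esub>"
      using am bn m n by (simp_all flip: G.nat_pow_Suc)
    then show "inv\<^bsub>G\<^esub> a = a [^]\<^bsub>G\<^esub> (m - 1)" "inv\<^bsub>G\<^esub> b = b [^]\<^bsub>G\<^esub> (n - 1)"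
      using ab by (simp_all add: G.inv_equality)
  qed
  have left_a: "a [^]\<^bsub>G\<^esub> l \<otimes>\<^bsub>G\<^esub> (a [^]\<^bsub>G\<^esub> i \<otimes>\<^bsub>G\<^esub> b [^]\<^bsub>G\<^esub> j) = a [^]\<^bsub>G\<^esub> (l + i) \<otimes>\<^bsub>G\<^esub> b [^]\<^bsub>G\<^esub> j" for l i j :: nat
    using ab by (simp add: G.nat_pow_mult flip: G.m_assoc)
  have left_b: "b [^]\<^bsub>G\<^esub> l \<otimes>\<^bsub>G\<^esub> (a [^]\<^bsub>G\<^esub> i \<otimes>\<^bsub>G\<^esub> b [^]\<^bsub>G\<^esub> j) = a [^]\<^bsub>G\<^esub> i \<otimes>\<^bsub>G\<^esub> b [^]\<^bsub>G\<^esub> (l * k ^ i + j)" for l i j :: nat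
  proof -
    have "b [^]\<^bsub>G\<^esub> l \<otimes>\<^bsub>G\<^esub> (a [^]\<^bsub>G\<^esub> i \<otimes>\<^bsub>G\<^esub> b [^]\<^bsub>G\<^esub> j) = (b [^]\<^bsub>G\<^esub> l \<otimes>\<^bsub>G\<^esub> a [^]\<^bsub>G\<^esub> i) \<otimes>\<^bsub>G\<^esub> b [^]\<^bsub>G\<^esub> j"
      using ab by (simp add: G.m_assoc)
    also have "\<dots> = a [^]\<^bsub>G\<^esub> i \<otimes>\<^bsub>G\<^esub> (b [^]\<^bsub>G\<^esub> (l * k ^ i) \<otimes>\<^bsub>G\<^esub> b [^]\<^bsub>G\<^esub> j)"
      using ab by (simp add: G.pow_swap[OF ab ba] G.m_assoc)
    finally show ?thesis using ab by (simp add: G.nat_pow_mult)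
  qed
  have step: "\<exists>(i' :: nat) (j' :: nat).
      z [^]\<^bsub>G\<^esub> l \<otimes>\<^bsub>G\<^esub> (a [^]\<^bsub>G\<^esub> i \<otimes>\<^bsub>G\<^esub> b [^]\<^bsub>G\<^esub> j) = a [^]\<^bsub>G\<^esub> i' \<otimes>\<^bsub>G\<^esub> b [^]\<^bsub>G\<^esub> j'"
    if "z \<in> {a, b}" for z and l i j :: nat
    using that left_a left_b by blast
  have nf: "\<exists>(i :: nat) (j :: nat). g = a [^]\<^bsub>G\<^esub> i \<otimes>\<^bsub>G\<^esub> b [^]\<^bsub>G\<^esub> j" if "g \<in> carrier G" for g
    using that
  proof (induction rule: presented_group_induct[OF R, folded G, consumes 1, case_names one gen inv_gen])
    case one
    have "\<one>\<^bsub>G\<^esub> = a [^]\<^bsub>G\<^esub> (0::nat) \<otimes>\<^bsub>G\<^esub> b [^]\<^bsub>G\<^esub> (0::nat)" by simp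
    then show ?case by blast
  next
    case (gen l g)
    then have z: "presented_gen ?S R l \<in> {a, b}" by (auto simp: a_def b_def)
    then have "presented_gen ?S R l [^]\<^bsub>G\<^esub> (1 :: nat) = presented_gen ?S R l"
      using ab by auto
    with gen.IH step[OF z, of 1] show ?case by metis
  next
    case (inv_gen l g)
    then have z: "presented_gen ?S R l \<in> {a, b}" by (auto simp: a_def b_def)
    then obtain e :: nat where "inv\<^bsub>G\<^esub> presented_gen ?S R l = presented_gen ?S R l [^]\<^bsub>G\<^esub> e"
      using inv by blast
    with inv_gen.IH step[OF z, of e] show ?case by metis
  qed
  have unique: "[i = i'] (mod m) \<and> [j = j'] (mod n)"
    if eq: "a [^]\<^bsub>G\<^esub> i \<otimes>\<^bsub>G\<^esub> b [^]\<^bsub>G\<^esub> j = a [^]\<^bsub>G\<^esub> i' \<otimes>\<^bsub>G\<^esub> b [^]\<^bsub>G\<^esub> j'" for i j i' j' :: nat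
  proof -
    from metacyclic_model[OF m n k] obtain H :: "(int \<times> int) monoid" and u v where H: "group H"
      and uv: "u \<in> carrier H" "v \<in> carrier H" "u [^]\<^bsub>H\<^esub> m = \<one>\<^bsub>H\<^esub>" "v [^]\<^bsub>H\<^esub> n = \<one>\<^bsub>H\<^esub>"
        "v \<otimes>\<^bsub>H\<^esub> u = u \<otimes>\<^bsub>H\<^esub> v [^]\<^bsub>H\<^esub> k"
      and sep: "\<forall>i j i' j'. u [^]\<^bsub>H\<^esub> i \<otimes>\<^bsub>H\<^esub> v [^]\<^bsub>H\<^esub> j = u [^]\<^bsub>H\<^esub> i' \<otimes>\<^bsub>H\<^esub> v [^]\<^bsub>H\<^esub> j' \<longrightarrow>
        [i = i'] (mod m) \<and> [j = j'] (mod n)"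
      by blast
    obtain h where h: "h \<in> hom G H" "h a = u" "h b = v"
      using lift[OF H uv] by blast
    interpret h: group_hom G H h
      using h H G.group_axioms by (simp add: group_hom_def group_hom_axioms_def)
    have "h (a [^]\<^bsub>G\<^esub> i \<otimes>\<^bsub>G\<^esub> b [^]\<^bsub>G\<^esub> j) = u [^]\<^bsub>H\<^esub> i \<otimes>\<^bsub>H\<^esub> v [^]\<^bsub>H\<^esub> j" for i j :: nat
      using ab h by (simp add: h.hom_nat_pow)
    then show ?thesis using sep eq by metis
  qed
  have "metacyclic G a b m n k"
    by unfold_locales (use ab am bn ba nf unique lift[OF G.group_axioms] in \<open>auto\<close>)
  then show ?thesis unfolding G_def by blast
qed

section \<open>Automorphisms\<close>

text \<open>
  The arithmetic that determines the automorphisms, for any modulus \<open>n\<close> whose group of units is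
  cyclic. Orders of residues are expressed by when two powers agree, because \<open>ord\<close> denotes the
  order of group elements in this scope.
\<close>

locale metacyclic_automorphisms = metacyclic G a b "q\<^sup>2" n k
  for G (structure) and a b and q n k :: nat +
  fixes g N :: nat
  assumes q: "q > 0" and n: "n > 0" and N: "N > 0"
    and coprime_qn: "coprime (q\<^sup>2) n"
    and k_order: "\<And>i j. [k ^ i = k ^ j] (mod n) \<longleftrightarrow> [i = j] (mod q)"
    and k_sum: "[(\<Sum>i<q. k ^ i) = 0] (mod n)"
    and g_order: "\<And>i j. [g ^ i = g ^ j] (mod n) \<longleftrightarrow> [i = j] (mod N)"
    and g_generates: "\<And>s. coprime s n \<Longrightarrow> \<exists>i. [s = g ^ i] (mod n)"
begin

lemma a_pow_cong: "[i = j] (mod q\<^sup>2) \<Longrightarrow> a [^] i = a [^] j"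
  by (rule nat_pow_cong[OF a_closed a_pow])

lemma b_pow_cong: "[i = j] (mod n) \<Longrightarrow> b [^] i = b [^] j"
  by (rule nat_pow_cong[OF b_closed b_pow])

lemma b_a_swap: "b [^] j \<otimes> a [^] i = a [^] i \<otimes> b [^] (j * k ^ i)" for i j :: nat
  by (rule pow_swap[OF a_closed b_closed swap])

lemma b_pow_a_swap:
  assumes "[t = 1] (mod q)"
  shows "b [^] j \<otimes> a [^] t = a [^] t \<otimes> b [^] (j * k)"
proof -
  have "[k ^ t = k ^ 1] (mod n)" using assms k_order by blast
  then have "[j * k ^ t = j * k] (mod n)" by (simp add: cong_scalar_left)
  then show ?thesis using b_pow_cong b_a_swap by metis
qed

lemma pow_normal_form:
  fixes t u i :: nat
  shows "(a [^] t \<otimes> b [^] u) [^] i = a [^] (t * i) \<otimes> b [^] (u * (\<Sum>j<i. (k ^ t) ^ j))"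
proof (induction i)
  case (Suc i)
  let ?S = "\<Sum>j<i. (k ^ t) ^ j"
  have S: "(\<Sum>j<Suc i. (k ^ t) ^ j) = ?S * k ^ t + 1"
    by (subst sum.lessThan_Suc_shift) (simp add: sum_distrib_left sum_distrib_right mult.commute)
  have "(a [^] t \<otimes> b [^] u) [^] Suc i
      = a [^] (t * i) \<otimes> (b [^] (u * ?S) \<otimes> a [^] t) \<otimes> b [^] u"
    using Suc.IH by (simp add: m_assoc)
  also have "\<dots> = (a [^] (t * i) \<otimes> a [^] t) \<otimes> (b [^] (u * ?S * k ^ t) \<otimes> b [^] u)"
    by (simp add: b_a_swap m_assoc)
  also have "\<dots> = a [^] (t * Suc i) \<otimes> b [^] (u * (\<Sum>j<Suc i. (k ^ t) ^ j))"
    by (simp only: nat_pow_mult a_closed b_closed S) (simp add: algebra_simps)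
  finally show ?case .
qed simp

lemma cong_one_plus: "[1 + q * l = 1] (mod q)"
  by (simp only: cong_def mod_mult_self2)

text \<open>
  The exponent of \<open>b\<close> in the power is \<open>u\<close> times a geometric sum with ratio \<open>k\<^sup>t = k\<close>, which
  vanishes.
\<close>

lemma pow_q:
  fixes t u :: nat
  assumes "[t = 1] (mod q)"
  shows "(a [^] t \<otimes> b [^] u) [^] q = a [^] (t * q)"
proof -
  have "[k ^ t = k ^ 1] (mod n)" using assms k_order by blast
  then have "[(\<Sum>j<q. (k ^ t) ^ j) = (\<Sum>j<q. (k ^ 1) ^ j)] (mod n)"
    by (intro cong_sum cong_pow)
  then have "[(\<Sum>j<q. (k ^ t) ^ j) = 0] (mod n)"
    using k_sum cong_trans by (simp only: power_one_right) blast
  then have "[u * (\<Sum>j<q. (k ^ t) ^ j) = 0] (mod n)"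
    using cong_scalar_left by fastforce
  then have "b [^] (u * (\<Sum>j<q. (k ^ t) ^ j)) = b [^] (0 :: nat)"
    by (rule b_pow_cong)
  then show ?thesis by (simp add: pow_normal_form)
qed

text \<open>
  Since \<open>a\<^sup>q\<close> is central, the contribution \<open>b\<^sup>u\<close> survives exactly once. This is why the third
  coordinate of an automorphism acts trivially on the first one.
\<close>

lemma pow_cong_one:
  fixes t u l :: nat
  assumes "[t = 1] (mod q)"
  shows "(a [^] t \<otimes> b [^] u) [^] (1 + q * l) = a [^] (t * (1 + q * l)) \<otimes> b [^] u"
proof -
  let ?x = "a [^] t \<otimes> b [^] u"
  have k: "[k ^ (t * (q * l)) = k ^ 0] (mod n)"
    unfolding k_order by (simp add: cong_def)
  have "?x [^] (1 + q * l) = ?x \<otimes> ?x [^] (q * l)"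
    by (subst nat_pow_mult[symmetric]) simp_all
  also have "?x [^] (q * l) = (?x [^] q) [^] l"
    by (simp add: nat_pow_pow)
  also have "\<dots> = (a [^] (t * q)) [^] l"
    by (simp only: pow_q[OF assms])
  also have "\<dots> = a [^] (t * (q * l))"
    by (simp add: nat_pow_pow mult.assoc)
  also have "?x \<otimes> \<dots> = a [^] t \<otimes> (b [^] u \<otimes> a [^] (t * (q * l)))"
    by (simp add: m_assoc)
  also have "b [^] u \<otimes> a [^] (t * (q * l)) = a [^] (t * (q * l)) \<otimes> b [^] u"
    using b_pow_cong[OF cong_scalar_left[OF k, of u]] by (simp add: b_a_swap)
  also have "a [^] t \<otimes> (a [^] (t * (q * l)) \<otimes> b [^] u) = a [^] (t * (1 + q * l)) \<otimes> b [^] u"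
    by (simp add: nat_pow_mult algebra_simps flip: m_assoc)
  finally show ?thesis .
qed

lemma hom_eqI:
  assumes "h \<in> hom G G" "h' \<in> hom G G" "h a = h' a" "h b = h' b" "x \<in> carrier G"
  shows "h x = h' x"
proof -
  interpret h: group_hom G G h + h': group_hom G G h'
    using assms by unfold_locales auto
  obtain i j :: nat where "x = a [^] i \<otimes> b [^] j"
    using normal_form[OF assms(5)] by blast
  then show ?thesis using assms by (simp add: h.hom_nat_pow h'.hom_nat_pow)
qed

text \<open>
  Extensionality singles out one function among those that agree on the group, as the elements of
  \<open>AutoGroup\<close> require.
\<close>

definition endo :: "nat \<Rightarrow> nat \<Rightarrow> nat \<Rightarrow> 'a \<Rightarrow> 'a"
  where "endo t u s = (SOME h. h \<in> hom G G \<and> h \<in> extensional (carrier G) \<and>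
    h a = a [^] t \<otimes> b [^] u \<and> h b = b [^] s)"

text \<open>
  The images of the generators satisfy the defining relations: \<open>(a\<^sup>t b\<^sup>u)\<^sup>q\<close> is \<open>a\<^bsup>tq\<^esup>\<close>, and conjugation
  by \<open>a\<^sup>t b\<^sup>u\<close> acts on powers of \<open>b\<close> as \<open>a\<close> does because \<open>t\<close> is 1 modulo \<open>q\<close>.
\<close>

lemma endo:
  assumes t: "[t = 1] (mod q)"
  shows "endo t u s \<in> hom G G" "endo t u s \<in> extensional (carrier G)"
    "endo t u s a = a [^] t \<otimes> b [^] u" "endo t u s b = b [^] s"
proof -
  let ?x = "a [^] t \<otimes> b [^] u"
  have "?x [^] q\<^sup>2 = (?x [^] q) [^] q"
    by (simp add: nat_pow_pow power2_eq_square)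
  also have "\<dots> = (a [^] (t * q)) [^] q"
    by (simp only: pow_q[OF t])
  also have "\<dots> = (a [^] q\<^sup>2) [^] t"
    by (simp add: nat_pow_pow power2_eq_square mult_ac)
  finally have x: "?x [^] q\<^sup>2 = \<one>" by (simp add: a_pow)
  have "(b [^] s) [^] n = (b [^] n) [^] s"
    by (simp add: nat_pow_pow mult.commute)
  then have y: "(b [^] s) [^] n = \<one>" by (simp add: b_pow)
  have "b [^] s \<otimes> ?x = (b [^] s \<otimes> a [^] t) \<otimes> b [^] u"
    by (simp add: m_assoc)
  also have "\<dots> = a [^] t \<otimes> (b [^] (s * k) \<otimes> b [^] u)"
    by (simp add: b_pow_a_swap[OF t] m_assoc)
  also have "\<dots> = ?x \<otimes> (b [^] s) [^] k"
    by (simp add: nat_pow_pow nat_pow_mult m_assoc add.commute)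
  finally obtain h where h: "h \<in> hom G G" "h a = ?x" "h b = b [^] s"
    using extend[OF _ _ x y] by auto
  then have "restrict h (carrier G) \<in> hom G G"
    by (auto simp: hom_def)
  then have "\<exists>h. h \<in> hom G G \<and> h \<in> extensional (carrier G) \<and> h a = ?x \<and> h b = b [^] s"
    using h by (intro exI[of _ "restrict h (carrier G)"]) auto
  from someI_ex[OF this, folded endo_def]
  show "endo t u s \<in> hom G G" "endo t u s \<in> extensional (carrier G)"
    "endo t u s a = ?x" "endo t u s b = b [^] s"
    by auto
qed

lemma endo_unique:
  assumes "[t = 1] (mod q)" "h \<in> hom G G" "h \<in> extensional (carrier G)"
    and "h a = a [^] t \<otimes> b [^] u" "h b = b [^] s"
  shows "endo t u s = h"
proof (rule extensionalityI[of _ "carrier G"])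
  fix x assume x: "x \<in> carrier G"
  show "endo t u s x = h x"
    by (rule hom_eqI[OF endo(1)[OF assms(1)] assms(2) _ _ x]) (simp_all add: endo[OF assms(1)] assms)
qed (use endo(2)[OF assms(1)] assms(3) in auto)

text \<open>
  Composition translates into \<open>(t, u, s)(t', u', s') = (t t', u + s u', s s')\<close>, the multiplication
  of a semidirect product.
\<close>

lemma compose_endo:
  assumes t: "[t = 1] (mod q)" and t': "t' = 1 + q * l" and T: "[T = t * t'] (mod q\<^sup>2)"
    and U: "[U = u + s * u'] (mod n)" and S: "[V = s * s'] (mod n)"
  shows "compose (carrier G) (endo t u s) (endo t' u' s') = endo T U V"
proof (rule endo_unique[symmetric])
  have t'1: "[t' = 1] (mod q)" unfolding t' by (rule cong_one_plus)
  have "[T = t * t'] (mod q)"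
    using T by (rule cong_dvd_modulus_nat) (simp add: power2_eq_square)
  with cong_mult[OF t t'1] show "[T = 1] (mod q)"
    using cong_trans by fastforce
  note e = endo[OF t, of u s] endo[OF t'1, of u' s']
  interpret h: group_hom G G "endo t u s"
    using e by unfold_locales auto
  show "compose (carrier G) (endo t u s) (endo t' u' s') \<in> hom G G"
    using hom_compose e by blast
  show "compose (carrier G) (endo t u s) (endo t' u' s') \<in> extensional (carrier G)"
    by simp
  have "endo t u s (a [^] t' \<otimes> b [^] u') = (a [^] t \<otimes> b [^] u) [^] t' \<otimes> (b [^] s) [^] u'"
    by (simp add: h.hom_nat_pow e)
  also have "\<dots> = a [^] (t * t') \<otimes> b [^] (u + s * u')"
    using pow_cong_one[OF t, of u l] by (simp add: t' m_assoc nat_pow_mult nat_pow_pow)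
  also have "\<dots> = a [^] T \<otimes> b [^] U"
    using a_pow_cong[OF T] b_pow_cong[OF U] by simp
  finally show "compose (carrier G) (endo t u s) (endo t' u' s') a = a [^] T \<otimes> b [^] U"
    by (simp add: compose_def e)
  show "compose (carrier G) (endo t u s) (endo t' u' s') b = b [^] V"
    using b_pow_cong[OF S] by (simp add: compose_def e h.hom_nat_pow nat_pow_pow)
qed

lemma endo_1: "endo 1 0 1 = (\<lambda>x\<in>carrier G. x)"
  by (rule endo_unique) (auto simp: hom_def)

abbreviation X where "X \<equiv> integer_mod_group n"
abbreviation Y where "Y \<equiv> integer_mod_group N \<times>\<times> integer_mod_group q"
abbreviation \<phi> where "\<phi> \<equiv> \<lambda>(i, l :: int). mult_action n g i"
abbreviation S where "S \<equiv> semidirect X \<phi> Y"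

definition \<Psi> :: "int \<times> int \<times> int \<Rightarrow> 'a \<Rightarrow> 'a"
  where "\<Psi> = (\<lambda>(u, i, l). endo (1 + q * nat l) (nat u) (g ^ nat i))"

lemma action_hom: "\<phi> \<in> hom Y (AutoGroup X)"
proof -
  have "[g ^ N = g ^ 0] (mod n)" unfolding g_order by (simp add: cong_def)
  then have "mult_action n g \<in> hom (integer_mod_group N) (AutoGroup X)"
    by (intro mult_action_hom) (simp_all add: n N)
  then show ?thesis
    by (auto simp: hom_def)
qed

lemma group_S: "group S"
  by (intro group_semidirect action_hom DirProd_group) simp_all

lemma carrier_S: "carrier S = {0..<int n} \<times> {0..<int N} \<times> {0..<int q}"
  using n N q by (simp add: semidirect_def carrier_integer_mod_group)

lemma S_cases:
  assumes "z \<in> carrier S"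
  obtains u i l :: nat where "z = (int u, int i, int l)" "u < n" "i < N" "l < q"
proof -
  obtain u i l where z: "z = (u, i, l)" by (cases z)
  show ?thesis
    by (rule that[of "nat u" "nat i" "nat l"]) (use assms in \<open>auto simp: z carrier_S\<close>)
qed

lemma S_closed:
  "u < n \<Longrightarrow> i < N \<Longrightarrow> l < q \<Longrightarrow> (int u, int i, int l) \<in> carrier S"
  by (simp add: carrier_S)

lemma S_mult:
  assumes "u' < n"
  shows "(int u, int i, int l) \<otimes>\<^bsub>S\<^esub> (int u', int i', int l') =
    (int ((u + g ^ i * u') mod n), int ((i + i') mod N), int ((l + l') mod q))"
proof -
  have "mult_action n g (int i) (int u') = int (g ^ i * u' mod n)"
    using assms by (simp add: mult_action_def carrier_integer_mod_group zmod_int)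
  moreover have "int ((u + g ^ i * u') mod n) = (int u + int (g ^ i * u' mod n)) mod int n"
    by (simp only: flip: of_nat_add zmod_int) (simp add: mod_add_right_eq)
  ultimately show ?thesis
    by (simp add: semidirect_def zmod_int del: of_nat_mult of_nat_power)
qed

text \<open>
  On exponents of the form \<open>1 + q l\<close> multiplication modulo \<open>q\<^sup>2\<close> is addition of \<open>l\<close> modulo \<open>q\<close>,
  and multiplication of powers of \<open>g\<close> is addition of exponents modulo \<open>N\<close>.
\<close>

lemma \<Psi>_mult:
  assumes "z \<in> carrier S" "z' \<in> carrier S"
  shows "\<Psi> (z \<otimes>\<^bsub>S\<^esub> z') = compose (carrier G) (\<Psi> z) (\<Psi> z')"
proof -
  obtain u i l where z: "z = (int u, int i, int l)" "u < n" "i < N" "l < q"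
    using assms(1) by (rule S_cases)
  obtain u' i' l' where z': "z' = (int u', int i', int l')" "u' < n" "i' < N" "l' < q"
    using assms(2) by (rule S_cases)
  have "compose (carrier G) (endo (1 + q * l) u (g ^ i)) (endo (1 + q * l') u' (g ^ i')) =
    endo (1 + q * ((l + l') mod q)) ((u + g ^ i * u') mod n) (g ^ ((i + i') mod N))"
  proof (rule compose_endo[where l = l'])
    show "[1 + q * l = 1] (mod q)" by (rule cong_one_plus)
    have "[1 + q * ((l + l') mod q) = 1 + q * (l + l')] (mod q * q)"
      by (intro cong_add cong_refl) (simp add: cong_def)
    also have "[1 + q * (l + l') = 1 + q * (l + l') + (q * q) * (l * l')] (mod q * q)"
      by (simp add: cong_def)
    finally show "[1 + q * ((l + l') mod q) = (1 + q * l) * (1 + q * l')] (mod q\<^sup>2)"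
      by (simp add: power2_eq_square algebra_simps)
    have "[g ^ ((i + i') mod N) = g ^ (i + i')] (mod n)"
      unfolding g_order by (simp add: cong_def)
    then show "[g ^ ((i + i') mod N) = g ^ i * g ^ i'] (mod n)"
      by (simp add: power_add)
  qed (simp_all add: cong_def)
  then show ?thesis
    by (simp add: z(1) z'(1) S_mult[OF z'(2)] \<Psi>_def)
qed

lemma \<Psi>_one: "\<Psi> \<one>\<^bsub>S\<^esub> = (\<lambda>x\<in>carrier G. x)"
  using endo_1 by (simp add: \<Psi>_def semidirect_def)

text \<open>
  Bijectivity comes for free: the domain is a group and composition is respected, so the value at
  the inverse is an inverse function.
\<close>

lemma \<Psi>_auto:
  assumes z: "z \<in> carrier S"
  shows "\<Psi> z \<in> auto G"
proof -
  interpret S: group "S" by (rule group_S)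
  have hom: "\<Psi> z \<in> hom G G" "\<Psi> z \<in> extensional (carrier G)"
    if zc: "z \<in> carrier S" for z
  proof -
    obtain u i l where z: "z = (int u, int i, int l)"
      using S_cases[OF zc] by metis
    from endo(1,2)[OF cong_one_plus] show "\<Psi> z \<in> hom G G" "\<Psi> z \<in> extensional (carrier G)"
      by (auto simp: \<Psi>_def z)
  qed
  let ?z' = "inv\<^bsub>S\<^esub> z"
  have cancel: "\<Psi> z1 (\<Psi> z2 x) = x"
    if "z1 \<in> carrier S" "z2 \<in> carrier S"
      "z1 \<otimes>\<^bsub>S\<^esub> z2 = \<one>\<^bsub>S\<^esub>" "x \<in> carrier G" for z1 z2 x
  proof -
    have "compose (carrier G) (\<Psi> z1) (\<Psi> z2) = (\<lambda>x\<in>carrier G. x)"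
      using \<Psi>_mult[OF that(1,2)] \<Psi>_one that(3) by metis
    from fun_cong[OF this, of x] show ?thesis using that(4) by (simp add: compose_def)
  qed
  have "bij_betw (\<Psi> z) (carrier G) (carrier G)"
  proof (rule bij_betw_byWitness[where f' = "\<Psi> ?z'"])
    show "\<forall>x\<in>carrier G. \<Psi> ?z' (\<Psi> z x) = x" "\<forall>x\<in>carrier G. \<Psi> z (\<Psi> ?z' x) = x"
      using cancel[of ?z' z] cancel[of z ?z'] z by simp_all
  qed (use hom[OF z] hom[of ?z'] z in \<open>auto simp: hom_def\<close>)
  then show ?thesis
    using hom[OF z] by (simp add: auto_def Bij_def)
qed

lemma \<Psi>_inj: "inj_on \<Psi> (carrier S)"
proof (rule inj_onI)
  fix z z' assume zz: "z \<in> carrier S" "z' \<in> carrier S"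
    and eq: "\<Psi> z = \<Psi> z'"
  obtain u i l where z: "z = (int u, int i, int l)" "u < n" "i < N" "l < q"
    using zz(1) by (rule S_cases)
  obtain u' i' l' where z': "z' = (int u', int i', int l')" "u' < n" "i' < N" "l' < q"
    using zz(2) by (rule S_cases)
  note t = cong_one_plus[of l] cong_one_plus[of l']
  have eq': "endo (1 + q * l) u (g ^ i) = endo (1 + q * l') u' (g ^ i')"
    using eq by (simp add: z(1) z'(1) \<Psi>_def)
  have "a [^] (1 + q * l) \<otimes> b [^] u = a [^] (1 + q * l') \<otimes> b [^] u'"
    using endo(3)[OF t(1), of u "g ^ i"] endo(3)[OF t(2), of u' "g ^ i'"] eq' by metis
  then have lu: "[1 + q * l = 1 + q * l'] (mod q\<^sup>2)" "[u = u'] (mod n)"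
    using normal_form_unique by blast+
  have "a [^] (0::nat) \<otimes> b [^] (g ^ i) = a [^] (0::nat) \<otimes> b [^] (g ^ i')"
    using endo(4)[OF t(1), of u "g ^ i"] endo(4)[OF t(2), of u' "g ^ i'"] eq' by metis
  then have "[i = i'] (mod N)"
    using normal_form_unique g_order by blast
  moreover have "[q * l = q * l'] (mod q * q)"
    using lu(1) by (simp only: cong_add_lcancel_nat power2_eq_square)
  then have "l = l'"
    using z z' q by (simp add: cong_def)
  ultimately show "z = z'"
    using lu z z' by (simp add: cong_def)
qed

text \<open>
  Let \<open>f\<close> be an automorphism. As \<open>q\<^sup>2\<close> and \<open>n\<close> are coprime, \<open>f b\<close>, whose \<open>n\<close>-th power is 1, is a
  power \<open>b\<^sup>s\<close>; injectivity forces \<open>s\<close> to be a unit. Comparing the two sides of the image of the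
  relation \<open>b a = a b\<^sup>k\<close> gives \<open>s k\<^sup>t = s k\<close> for the exponent \<open>t\<close> of \<open>a\<close> in \<open>f a\<close>, whence \<open>t\<close> is
  1 modulo \<open>q\<close>.
\<close>

lemma \<Psi>_surj:
  assumes f: "f \<in> auto G"
  shows "\<exists>z\<in>carrier S. f = \<Psi> z"
proof -
  have f: "f \<in> hom G G" "f \<in> extensional (carrier G)" "inj_on f (carrier G)"
    using f by (auto simp: auto_def Bij_def bij_betw_def)
  interpret f: group_hom G G f using f by unfold_locales
  obtain t u :: nat where fa: "f a = a [^] t \<otimes> b [^] u"
    using normal_form[of "f a"] by auto
  obtain v s :: nat where fb': "f b = a [^] v \<otimes> b [^] s"
    using normal_form[of "f b"] by auto
  have "f b [^] n = \<one>"
    using f.hom_nat_pow[of b n] by (simp add: b_pow)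
  then have "a [^] (v * n) \<otimes> b [^] (s * (\<Sum>j<n. (k ^ v) ^ j)) = a [^] (0::nat) \<otimes> b [^] (0::nat)"
    by (simp add: fb' pow_normal_form)
  then have "[v * n = 0 * n] (mod q\<^sup>2)"
    using normal_form_unique by (simp only: mult_0)
  then have "[v = 0] (mod q\<^sup>2)"
    using coprime_qn cong_mult_rcancel_nat[of n "q\<^sup>2" v 0] by (simp add: coprime_commute)
  then have fb: "f b = b [^] s"
    using a_pow_cong[of v 0] by (simp add: fb')
  have "coprime s n"
  proof -
    \<comment> \<open>The power of b with exponent n div d lies in the kernel of f.\<close>
    let ?d = "gcd s n"
    have "s * (n div ?d) = n * (s div ?d)"
      by (simp add: div_mult_swap dvd_div_mult mult.commute)
    then have "f (b [^] (n div ?d)) = (b [^] n) [^] (s div ?d)"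
      by (simp add: f.hom_nat_pow fb nat_pow_pow)
    also have "\<dots> = f \<one>" by (simp add: b_pow)
    finally have "b [^] (n div ?d) = \<one>"
      using inj_onD[OF f(3), of "b [^] (n div ?d)" "\<one>"] by simp
    then have "a [^] (0::nat) \<otimes> b [^] (n div ?d) = a [^] (0::nat) \<otimes> b [^] (0::nat)"
      by simp
    then have "n dvd n div ?d"
      using normal_form_unique cong_0_iff by blast
    then have "n \<le> n div ?d"
      using n by (intro dvd_imp_le) (simp_all add: div_greater_zero_iff gcd_le2_nat)
    then have "\<not> ?d > 1"
      using n by (metis div_less_dividend leD)
    moreover have "?d > 0" using n by simp
    ultimately have "?d = 1" by linarith
    then show ?thesis by (simp only: coprime_iff_gcd_eq_1)
  qed
  then obtain i where i: "[s = g ^ i] (mod n)" using g_generates by blast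
  have "f b \<otimes> f a = f a \<otimes> f b [^] k"
    using arg_cong[OF swap, of f] by (simp add: f.hom_nat_pow)
  then have "(b [^] s \<otimes> a [^] t) \<otimes> b [^] u = a [^] t \<otimes> b [^] (u + s * k)"
    by (simp add: fa fb m_assoc nat_pow_pow nat_pow_mult)
  then have "a [^] t \<otimes> b [^] (u + s * k ^ t) = a [^] t \<otimes> b [^] (u + s * k)"
    by (simp add: b_a_swap m_assoc nat_pow_mult add.commute)
  then have "[u + s * k ^ t = u + s * k ^ 1] (mod n)"
    using normal_form_unique by fastforce
  then have "[k ^ t = k ^ 1] (mod n)"
    using \<open>coprime s n\<close> by (simp only: cong_add_lcancel_nat cong_mult_lcancel_nat)
  then have t: "[t = 1] (mod q)" unfolding k_order .
  \<comment> \<open>Adding the order of a makes the exponent positive, so that subtracting 1 does not truncate.\<close>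
  have "[t + q\<^sup>2 = 1] (mod q)"
    using t by (simp add: cong_def power2_eq_square)
  moreover have pos: "1 \<le> t + q\<^sup>2"
    using q by (simp add: Suc_le_eq)
  ultimately have "q dvd t + q\<^sup>2 - 1"
    using cong_altdef_nat[OF pos] by blast
  then obtain w where w: "t + q\<^sup>2 = 1 + q * w"
    using pos by (metis dvd_def le_add_diff_inverse)
  have "[q * (w mod q) = q * w] (mod q\<^sup>2)"
    by (simp add: cong_def power2_eq_square)
  then have "[1 + q * (w mod q) = t + q\<^sup>2] (mod q\<^sup>2)"
    unfolding w by (intro cong_add cong_refl)
  then have "[1 + q * (w mod q) = t] (mod q\<^sup>2)"
    by (simp add: cong_def)
  then have "f a = a [^] (1 + q * (w mod q)) \<otimes> b [^] (u mod n)"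
    using a_pow_cong[of "1 + q * (w mod q)" t] b_pow_cong[of "u mod n" u]
    by (simp only: fa) (simp add: cong_def)
  moreover have "f b = b [^] (g ^ (i mod N))"
  proof -
    have "[g ^ i = g ^ (i mod N)] (mod n)" unfolding g_order by (simp add: cong_def)
    then show ?thesis using b_pow_cong cong_trans[OF i] by (simp add: fb)
  qed
  ultimately have "endo (1 + q * (w mod q)) (u mod n) (g ^ (i mod N)) = f"
    by (intro endo_unique cong_one_plus f)
  then have "f = \<Psi> (int (u mod n), int (i mod N), int (w mod q))"
    by (simp add: \<Psi>_def nat_mod_distrib flip: of_nat_mod)
  moreover have "(int (u mod n), int (i mod N), int (w mod q)) \<in> carrier S"
    using n N q by (intro S_closed) simp_all
  ultimately show ?thesis by blast
qed

theorem automorphisms_iso: "AutoGroup G \<cong> S"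
proof -
  have "\<Psi> \<in> iso S (AutoGroup G)"
  proof (rule isoI)
    show "\<Psi> \<in> hom S (AutoGroup G)"
    proof (rule homI)
      fix z z' assume zz: "z \<in> carrier S" "z' \<in> carrier S"
      show "\<Psi> (z \<otimes>\<^bsub>S\<^esub> z') = \<Psi> z \<otimes>\<^bsub>AutoGroup G\<^esub> \<Psi> z'"
        using \<Psi>_auto[OF zz(1)] \<Psi>_auto[OF zz(2)] \<Psi>_mult[OF zz]
        by (simp add: AutoGroup_def BijGroup_def auto_def)
    qed (use \<Psi>_auto in \<open>simp add: AutoGroup_def\<close>)
    show "bij_betw \<Psi> (carrier S) (carrier (AutoGroup G))"
      unfolding bij_betw_def
    proof
      show "\<Psi> ` carrier S = carrier (AutoGroup G)"
        using \<Psi>_auto \<Psi>_surj by (simp add: AutoGroup_def) blast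
    qed (rule \<Psi>_inj)
  qed
  then show ?thesis
    using group.iso_sym[OF group_S] is_isoI by blast
qed

end

section \<open>Roots of unity modulo a prime square\<close>

text \<open>
  The product of \<open>k - 1\<close> with the sum is \<open>k\<^sup>q - 1\<close>. If \<open>p\<close> divided \<open>k - 1\<close>, the sum would be \<open>q\<close>
  modulo \<open>p\<close>, hence a unit, and \<open>p\<^sup>2\<close> would divide \<open>k - 1\<close>. So \<open>k - 1\<close> is a unit instead.
\<close>

lemma geometric_sum_prime_square:
  fixes p q k :: nat
  assumes p: "prime p" and q: "prime q" "p \<noteq> q" and k: "[k ^ q = 1] (mod p\<^sup>2)" "[k \<noteq> 1] (mod p\<^sup>2)"
  shows "[(\<Sum>i<q. k ^ i) = 0] (mod p\<^sup>2)"
proof -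
  let ?S = "\<Sum>i<q. int k ^ i"
  have "[int (k ^ q) = int 1] (mod int (p\<^sup>2))"
    using k(1) by (simp only: cong_int_iff)
  then have dvd: "int (p\<^sup>2) dvd (int k - 1) * ?S"
    by (simp add: power_diff_1_eq cong_iff_dvd_diff)
  have not1: "\<not> int (p\<^sup>2) dvd int k - 1"
    using k(2) cong_int_iff[of k 1 "p\<^sup>2"] by (simp add: cong_iff_dvd_diff)
  have "\<not> int p dvd int k - 1"
  proof
    assume "int p dvd int k - 1"
    then have "[int k = 1] (mod int p)" by (simp add: cong_iff_dvd_diff)
    then have "[?S = (\<Sum>i<q. 1 ^ i)] (mod int p)" by (intro cong_sum cong_pow)
    then have S: "[?S = int q] (mod int p)" by simp
    have "coprime (int q) (int p)" using p q by (simp add: primes_coprime coprime_commute)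
    then have "coprime ?S (int p)"
      using cong_imp_coprime[OF cong_sym[OF S]] by blast
    then have "coprime (int (p\<^sup>2)) ?S" by (simp add: coprime_commute)
    then show False using dvd not1 by (simp add: coprime_dvd_mult_left_iff)
  qed
  then have "coprime (int p) (int k - 1)"
    using p prime_imp_coprime by (metis prime_int_nat_transfer prime_nat_int_transfer)
  then have "int (p\<^sup>2) dvd ?S"
    using dvd by (simp add: coprime_dvd_mult_right_iff)
  then have "int (p\<^sup>2) dvd int (\<Sum>i<q. k ^ i)" by simp
  then show ?thesis
    by (simp only: int_dvd_int_iff cong_0_iff)
qed

theorem mainTheorem2:
  fixes p q :: nat and r :: int
  assumes "prime p" and "prime q" and "p \<noteq> q" and "p * q \<noteq> 6" and "q dvd p - 1"
    and "[r ^ q = 1] (mod int (p\<^sup>2))" and "[r \<noteq> 1] (mod int (p\<^sup>2))"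
  defines "G \<equiv> metacyclic_group (q\<^sup>2) (p\<^sup>2) r"
  defines "X \<equiv> integer_mod_group (p\<^sup>2)"
    and "Y \<equiv> integer_mod_group (p * (p - 1)) \<times>\<times> integer_mod_group q"
  shows "\<exists>\<phi>\<in>hom Y (AutoGroup X). AutoGroup G \<cong> semidirect X \<phi> Y"
proof -
  have q1: "q > 1" and p1: "p > 1" using assms(1,2) prime_gt_1_nat by auto
  have "q \<le> p - 1" using assms(5) p1 by (intro dvd_imp_le) auto
  then have "p > 2" using q1 by simp
  then have "odd p" using assms(1) prime_odd_nat by blast
  define k where "k = nat (r mod int (p\<^sup>2))"
  have p2: "int (p\<^sup>2) > 0" using p1 by simp
  have r: "[r = int k] (mod int (p\<^sup>2))"
    using p2 by (simp add: k_def cong_def)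
  have "[int k ^ q = 1] (mod int (p\<^sup>2))"
    using cong_pow[OF r, of q] assms(6) cong_sym cong_trans by blast
  then have kq: "[k ^ q = 1] (mod p\<^sup>2)"
    using cong_int_iff[of "k ^ q" 1 "p\<^sup>2"] by (simp only: of_nat_power of_nat_1)
  have k1: "[k \<noteq> 1] (mod p\<^sup>2)"
    using r assms(7) cong_int_iff[of k 1 "p\<^sup>2"] cong_trans by fastforce
  have ord: "ord (p\<^sup>2) k = q"
  proof -
    have "ord (p\<^sup>2) k dvd q" using kq ord_divides by blast
    moreover have "ord (p\<^sup>2) k \<noteq> 1"
      using k1 ord_divides[of k 1 "p\<^sup>2"] by auto
    ultimately show ?thesis using assms(2) prime_nat_iff by blast
  qed
  have cop_k: "coprime (p\<^sup>2) k"
    using ord q1 by (metis ord_eq_0 not_less_zero)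
  obtain g where "\<forall>j>0. residue_primroot (p ^ j) g"
    using residue_primroot_odd_prime_power_exists assms(1) \<open>odd p\<close> by blast
  then have g: "residue_primroot (p\<^sup>2) g" by simp
  have tot: "totient (p\<^sup>2) = p * (p - 1)"
    using totient_prime_power[OF assms(1), of 2] by simp
  have "[k ^ q\<^sup>2 = 1] (mod p\<^sup>2)"
    using ord_divides ord by (metis dvd_triv_left power2_eq_square)
  then obtain a b where G: "metacyclic G a b (q\<^sup>2) (p\<^sup>2) k"
    using metacyclic_group_is_metacyclic[of "q\<^sup>2" "p\<^sup>2" k r] r p1 q1 unfolding G_def by auto
  have "metacyclic_automorphisms G a b q (p\<^sup>2) k g (p * (p - 1))"
  proof (intro metacyclic_automorphisms.intro metacyclic_automorphisms_axioms.intro G)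
    show "q > 0" "p\<^sup>2 > 0" "p * (p - 1) > 0" using p1 q1 by simp_all
    show "coprime (q\<^sup>2) (p\<^sup>2)" using assms(1-3) by (simp add: primes_coprime)
    show "[k ^ i = k ^ j] (mod p\<^sup>2) \<longleftrightarrow> [i = j] (mod q)" for i j
      using order_divides_expdiff[OF cop_k] ord by simp
    show "[(\<Sum>i<q. k ^ i) = 0] (mod p\<^sup>2)"
      using geometric_sum_prime_square[OF assms(1-3) kq k1] .
    show "[g ^ i = g ^ j] (mod p\<^sup>2) \<longleftrightarrow> [i = j] (mod p * (p - 1))" for i j
      using g order_divides_expdiff tot by (metis residue_primroot_def)
    show "\<exists>i. [s = g ^ i] (mod p\<^sup>2)" if "coprime s (p\<^sup>2)" for s
    proof -
      have cop: "coprime (s mod p\<^sup>2) (p\<^sup>2)"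
        using that p1 by (subst coprime_mod_left_iff) auto
      have "s mod p\<^sup>2 \<noteq> 0"
      proof
        assume "s mod p\<^sup>2 = 0"
        with cop show False using p1 by simp
      qed
      with cop have "s mod p\<^sup>2 \<in> totatives (p\<^sup>2)"
        using p1 by (simp only: in_totatives_iff) (simp add: less_imp_le)
      moreover have "(\<lambda>i. g ^ i mod p\<^sup>2) ` {..<totient (p\<^sup>2)} = totatives (p\<^sup>2)"
        using p1 by (intro bij_betw_imp_surj_on residue_primroot_is_generator g one_less_power) simp_all
      ultimately obtain i where "s mod p\<^sup>2 = g ^ i mod p\<^sup>2"
        by blast
      then show ?thesis by (auto simp: cong_def)
    qed
  qed
  then interpret metacyclic_automorphisms G a b q "p\<^sup>2" k g "p * (p - 1)" .
  show ?thesis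
    using action_hom automorphisms_iso unfolding X_def Y_def by blast
qed

end
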